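(* If $G$ and $H$ are Left dead ends with $G\geq H$, then $\mathcal{T}(G)\subseteq\mathcal{T}(H)$.
   Context: All games are short partizan combinatorial game forms; $G+H$ is the disjunctive sum; $\cong$ denotes identity of game forms. Play is misère (a player unable to move wins). Misère outcome classes are ordered $\mathscr L>\mathscr P>\mathscr R$ and $\mathscr L>\mathscr N>\mathscr R$; $G\geq H$ means that for every game $X$ the misère outcome of $G+X$ is $\geq$ that of $H+X$. A Left dead end is a game no subposition of which (including itself) has a Left option; its options are its Right options. A run of length $k$ of $G$ is a sequence $(G_0,G_1,\dots,G_k)$ with $G_0\cong G$ and $G_{i+1}$ an option of $G_i$ for each $i$; it is terminal if $G_k\cong 0=\{\cdot\mid\cdot\}$. The set of terminal lengths $\mathcal{T}(G)$ is the set of all $n$ such that $G$ has a terminal run of length $n$. *)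

theory Defs
  imports Main "HOL-Library.FSet"
begin

text \<open>Short game forms: the options on each side form a finite set, so HOL equality is
  the identity of forms, and well-foundedness comes from the datatype.\<close>

datatype game = Game (left_opts: "game fset") (right_opts: "game fset")

lemma size_left_option: "K |\<in>| left_opts G \<Longrightarrow> size K < size G"
  by (cases G) (auto simp: less_Suc_eq_le size_fset_simps dest!: sum.remove[where g = "\<lambda>x. Suc (size x)", OF finite_fset])

lemma size_right_option: "K |\<in>| right_opts G \<Longrightarrow> size K < size G"
  by (cases G) (auto simp: less_Suc_eq_le size_fset_simps dest!: sum.remove[where g = "\<lambda>x. Suc (size x)", OF finite_fset])

instantiation game :: zero
begin
definition "0 = Game {||} {||}"
instance ..
end

function game_sum :: "game \<Rightarrow> game \<Rightarrow> game" where
  "game_sum G H = Game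
     ((\<lambda>K. game_sum K H) |`| left_opts G |\<union>| (\<lambda>K. game_sum G K) |`| left_opts H)
     ((\<lambda>K. game_sum K H) |`| right_opts G |\<union>| (\<lambda>K. game_sum G K) |`| right_opts H)"
  by auto
termination
  by (relation "measure (\<lambda>(G, H). size G + size H)")
     (auto dest: size_left_option size_right_option)

declare game_sum.simps [simp del]

instantiation game :: plus
begin
definition "G + H = game_sum G H"
instance ..
end

datatype player = Left | Right

fun opponent :: "player \<Rightarrow> player" where
  "opponent Left = Right"
| "opponent Right = Left"

fun options_of :: "player \<Rightarrow> game \<Rightarrow> game fset" where
  "options_of Left G = left_opts G"
| "options_of Right G = right_opts G"

lemma size_options_of: "K |\<in>| options_of p G \<Longrightarrow> size K < size G"
  by (cases p) (auto dest: size_left_option size_right_option)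

text \<open>Misere play: a player to move who has no option wins.\<close>

function wins_moving_first :: "player \<Rightarrow> game \<Rightarrow> bool" where
  "wins_moving_first p G \<longleftrightarrow>
     options_of p G = {||} \<or>
     (\<exists>K\<in>fset (options_of p G). \<not> wins_moving_first (opponent p) K)"
  by auto
termination
  by (relation "measure (\<lambda>(p, G). size G)") (auto dest: size_options_of)

declare wins_moving_first.simps [simp del]

datatype outcome = Outcome_L | Outcome_P | Outcome_N | Outcome_R

definition misere_outcome :: "game \<Rightarrow> outcome" where
  "misere_outcome G =
     (if wins_moving_first Left G
      then (if wins_moving_first Right G then Outcome_N else Outcome_L)
      else (if wins_moving_first Right G then Outcome_R else Outcome_P))"

instantiation outcome :: order
begin

definition less_outcome :: "outcome \<Rightarrow> outcome \<Rightarrow> bool" where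
  "a < b \<longleftrightarrow> a \<noteq> b \<and> (a = Outcome_R \<or> b = Outcome_L)"

definition less_eq_outcome :: "outcome \<Rightarrow> outcome \<Rightarrow> bool" where
  "a \<le> b \<longleftrightarrow> a < b \<or> a = (b :: outcome)"

instance
  by standard (auto simp: less_outcome_def less_eq_outcome_def)

end

definition game_ge :: "game \<Rightarrow> game \<Rightarrow> bool" where
  "game_ge G H \<longleftrightarrow> (\<forall>X. misere_outcome (G + X) \<ge> misere_outcome (H + X))"

definition is_option :: "game \<Rightarrow> game \<Rightarrow> bool" where
  "is_option K G \<longleftrightarrow> K |\<in>| left_opts G \<or> K |\<in>| right_opts G"

definition subposition :: "game \<Rightarrow> game \<Rightarrow> bool" where
  "subposition = is_option\<^sup>*\<^sup>*"

definition left_dead_end :: "game \<Rightarrow> bool" where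
  "left_dead_end G \<longleftrightarrow> (\<forall>K. subposition K G \<longrightarrow> left_opts K = {||})"

text \<open>A run \<open>(G\<^sub>0, \<dots>, G\<^sub>k)\<close> of length \<open>k\<close> is a list with \<open>k + 1\<close> entries.\<close>

definition run_of_length :: "nat \<Rightarrow> game \<Rightarrow> game list \<Rightarrow> bool" where
  "run_of_length k G xs \<longleftrightarrow>
     length xs = Suc k \<and> xs ! 0 = G \<and> (\<forall>i<k. is_option (xs ! Suc i) (xs ! i))"

definition terminal_lengths :: "game \<Rightarrow> nat set" where
  "terminal_lengths G = {n. \<exists>xs. run_of_length n G xs \<and> xs ! n = 0}"

end

theory Submission
  imports Defs
begin

text \<open>Let \<open>X\<^sub>0 = 0\<close> and \<open>X\<^sub>n\<^sub>+\<^sub>1 = {X\<^sub>n | 0}\<close>. In \<open>K + X\<^sub>n\<close>, for \<open>K\<close> a Left dead end, Left can only count \<open>X\<^sub>n\<close>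
  down, while Right loses as soon as he moves in \<open>X\<^sub>n\<close>, since Left then has no move. So Right,
  moving first, wins exactly if he can exhaust \<open>K\<close> in precisely \<open>n\<close> moves, and \<open>X\<^sub>n\<close>
  distinguishes \<open>G\<close> from \<open>H\<close> whenever \<open>n\<close> lies in the difference of the terminal lengths.\<close>

primrec countdown :: "nat \<Rightarrow> game" where
  "countdown 0 = 0"
| "countdown (Suc n) = Game {|countdown n|} {|0|}"

lemma options_zero [simp]: "left_opts 0 = {||}" "right_opts 0 = {||}"
  by (simp_all add: zero_game_def)

lemma left_opts_add:
  "left_opts (G + H) = (\<lambda>K. K + H) |`| left_opts G |\<union>| (\<lambda>K. G + K) |`| left_opts H"
  by (simp add: plus_game_def game_sum.simps[of G H])

lemma right_opts_add:
  "right_opts (G + H) = (\<lambda>K. K + H) |`| right_opts G |\<union>| (\<lambda>K. G + K) |`| right_opts H"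
  by (simp add: plus_game_def game_sum.simps[of G H])

lemma left_dead_end_left_opts: "left_dead_end G \<Longrightarrow> left_opts G = {||}"
  by (simp add: left_dead_end_def subposition_def)

lemma left_dead_end_right_option:
  "left_dead_end G \<Longrightarrow> K |\<in>| right_opts G \<Longrightarrow> left_dead_end K"
  unfolding left_dead_end_def subposition_def
  by (meson is_option_def rtranclp.rtrancl_into_rtrancl)

lemma zero_mem_terminal_lengths_iff: "0 \<in> terminal_lengths G \<longleftrightarrow> G = 0"
proof
  show "G = 0" if "0 \<in> terminal_lengths G"
    using that by (auto simp: terminal_lengths_def run_of_length_def)
  show "0 \<in> terminal_lengths G" if "G = 0"
    using that by (auto simp: terminal_lengths_def run_of_length_def intro!: exI[of _ "[G]"])
qed

text \<open>Removing or prepending the starting position shifts a run by one index. Play in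
  \<open>K + countdown n\<close> has to match this recursion.\<close>

lemma Suc_mem_terminal_lengths_iff:
  "Suc n \<in> terminal_lengths G \<longleftrightarrow> (\<exists>K. is_option K G \<and> n \<in> terminal_lengths K)"
proof
  assume "Suc n \<in> terminal_lengths G"
  then obtain xs where xs: "run_of_length (Suc n) G xs" "xs ! Suc n = 0"
    by (auto simp: terminal_lengths_def)
  then obtain ys where ys: "xs = G # ys"
    by (cases xs) (auto simp: run_of_length_def)
  have "is_option (ys ! 0) G" "run_of_length n (ys ! 0) ys"
    using xs(1) by (auto simp: run_of_length_def ys All_less_Suc2)
  then show "\<exists>K. is_option K G \<and> n \<in> terminal_lengths K"
    using xs(2) by (auto simp: terminal_lengths_def ys)
next
  assume "\<exists>K. is_option K G \<and> n \<in> terminal_lengths K"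
  then obtain K xs where "is_option K G" "run_of_length n K xs" "xs ! n = 0"
    by (auto simp: terminal_lengths_def)
  then have "run_of_length (Suc n) G (G # xs)" "(G # xs) ! Suc n = 0"
    by (auto simp: run_of_length_def All_less_Suc2)
  then show "Suc n \<in> terminal_lengths G"
    by (auto simp: terminal_lengths_def)
qed

text \<open>Neither summand offers Left a move, so any move of Right to such a sum loses.\<close>

lemma Left_wins_moving_first_add_zero:
  "left_dead_end K \<Longrightarrow> wins_moving_first Left (K + 0)"
  by (subst wins_moving_first.simps) (simp add: left_opts_add left_dead_end_left_opts)

lemma Left_wins_moving_first_add_countdown_Suc:
  assumes "left_dead_end K"
  shows "wins_moving_first Left (K + countdown (Suc n)) \<longleftrightarrow>
    \<not> wins_moving_first Right (K + countdown n)"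
  by (subst wins_moving_first.simps)
    (simp add: left_opts_add left_dead_end_left_opts[OF assms])

text \<open>Every move of Right leaves Left unable to move, so Right wins only when already out of
  moves, which for a Left dead end means \<open>0\<close>.\<close>

lemma Right_wins_moving_first_add_zero_iff:
  assumes "left_dead_end K"
  shows "wins_moving_first Right (K + 0) \<longleftrightarrow> K = 0"
proof -
  have "wins_moving_first Left (K' + 0)" if "K' |\<in>| right_opts K" for K'
    by (rule Left_wins_moving_first_add_zero[OF left_dead_end_right_option[OF assms that]])
  then have "wins_moving_first Right (K + 0) \<longleftrightarrow> right_opts K = {||}"
    by (subst wins_moving_first.simps) (auto simp: right_opts_add)
  also have "\<dots> \<longleftrightarrow> K = 0"
    using left_dead_end_left_opts[OF assms] by (cases K) (simp add: zero_game_def)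
  finally show ?thesis .
qed

text \<open>Right's move to \<open>K + 0\<close> loses, so Right has to move in \<open>K\<close>;
  Left's forced reply then lowers the counter by one.\<close>

lemma Right_wins_moving_first_add_countdown_Suc:
  assumes "left_dead_end K"
  shows "wins_moving_first Right (K + countdown (Suc n)) \<longleftrightarrow>
    (\<exists>K'. K' |\<in>| right_opts K \<and> wins_moving_first Right (K' + countdown n))"
proof -
  have "wins_moving_first Right (K + countdown (Suc n)) \<longleftrightarrow>
      (\<exists>K'. K' |\<in>| right_opts K \<and> \<not> wins_moving_first Left (K' + countdown (Suc n)))"
    using Left_wins_moving_first_add_zero[OF assms]
    by (subst wins_moving_first.simps) (auto simp: right_opts_add)
  then show ?thesis
    using Left_wins_moving_first_add_countdown_Suc left_dead_end_right_option[OF assms]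
    by blast
qed

lemma Right_wins_moving_first_add_countdown_iff:
  assumes "left_dead_end K"
  shows "wins_moving_first Right (K + countdown n) \<longleftrightarrow> n \<in> terminal_lengths K"
  using assms
proof (induction n arbitrary: K)
  case 0
  then show ?case
    by (simp add: Right_wins_moving_first_add_zero_iff zero_mem_terminal_lengths_iff)
next
  case (Suc n)
  \<comment> \<open>Runs may use options of either player, but here only Right's exist, so both
    recursions range over the same positions.\<close>
  have "is_option K' K \<longleftrightarrow> K' |\<in>| right_opts K" for K'
    using left_dead_end_left_opts[OF Suc.prems] by (simp add: is_option_def)
  then show ?case
    unfolding Right_wins_moving_first_add_countdown_Suc[OF Suc.prems] Suc_mem_terminal_lengths_iff
    using Suc.IH left_dead_end_right_option[OF Suc.prems] by blast
qed

text \<open>Right wins moving first exactly in the outcomes N and R, which form a down-set of the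
  order.\<close>

lemma game_ge_Right_wins_moving_first:
  assumes "game_ge G H" "wins_moving_first Right (G + X)"
  shows "wins_moving_first Right (H + X)"
proof -
  have "misere_outcome (H + X) \<le> misere_outcome (G + X)"
    using assms(1) by (simp add: game_ge_def)
  then show ?thesis
    using assms(2)
    by (auto simp: misere_outcome_def less_eq_outcome_def less_outcome_def split: if_splits)
qed

theorem mainTheorem4:
  fixes G H :: game
  assumes "left_dead_end G" and "left_dead_end H"
    and "game_ge G H"
  shows "terminal_lengths G \<subseteq> terminal_lengths H"
  \<comment> \<open>With membership of \<open>n\<close> rewritten as a win for Right, the inequality
    is applied at \<open>X\<close> = \<open>countdown n\<close>.\<close>
  using assms game_ge_Right_wins_moving_first
  by (auto simp flip: Right_wins_moving_first_add_countdown_iff)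

end
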